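(* Let $f\colon \mathbb{H}\to\mathbb{C}$ be a non-constant modular function satisfying the divisor condition. Let $g_1,\ldots,g_n\in\mathrm{GL}_2^+(\mathbb{Q})$. If the functions $f(g_1z),\ldots,f(g_nz)$ are pairwise distinct, then they are multiplicatively independent modulo constants, i.e. there are no $a_1,\ldots,a_n\in\mathbb{Z}$, not all zero, and $c\in\mathbb{C}$ with $\prod_{i=1}^n f(g_iz)^{a_i}=c$ identically.
   Context: $\mathbb{H}$ is the complex upper half-plane; $\mathrm{GL}_2^+(\mathbb{Q})$ (rational $2\times 2$ matrices of positive determinant) acts on $\mathbb{H}$ by Möbius transformations. $j$ is the modular $j$-function. A modular function is a meromorphic $f\colon\mathbb{H}\to\mathbb{C}$ invariant under $\mathrm{SL}_2(\mathbb{Z})$ and meromorphic at the cusp (Fourier expansion $\sum_{n\ge -m}a(n)q^n$, $q=e^{2\pi i z}$); equivalently $f=R(j)$ for some $R\in\mathbb{C}(t)$. Let $F_j=\{z\in\mathbb{H}: -\tfrac12<\mathrm{Re}(z)\le\tfrac12,\ |z|\ge1,\ \text{and } |z|>1 \text{ if } -\tfrac12<\mathrm{Re}(z)<0\}$. A non-constant modular function has finitely many (and at least one) zeros and poles in $F_j$; enumerate them as $w_1,\ldots,w_r$ with $\mathrm{Im}(w_i)\le \mathrm{Im}(w_{i+1})$. $f$ satisfies the divisor condition if $w_r+s$ is neither a zero nor a pole of $f$ for all $0<s<1$. *)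

theory Defs
  imports "HOL-Complex_Analysis.Complex_Analysis"
begin

definition upper_half_plane :: "complex set" where
  "upper_half_plane = {z. Im z > 0}"

definition GL2_plus_Q :: "(rat^2^2) set" where
  "GL2_plus_Q = {g. det g > 0}"

definition SL2_Z :: "(rat^2^2) set" where
  "SL2_Z = {g. det g = 1 \<and> (\<forall>i k. g $ i $ k \<in> \<int>)}"

definition moebius_action :: "rat^2^2 \<Rightarrow> complex \<Rightarrow> complex" where
  "moebius_action g z = (of_rat (g $ 1 $ 1) * z + of_rat (g $ 1 $ 2)) /
                        (of_rat (g $ 2 $ 1) * z + of_rat (g $ 2 $ 2))"

definition meromorphic_at_cusp :: "(complex \<Rightarrow> complex) \<Rightarrow> bool" where
  "meromorphic_at_cusp f \<longleftrightarrow>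
     (\<exists>(m::int) (a::int \<Rightarrow> complex) (Y::real). \<forall>z. Im z > Y \<longrightarrow>
        ((\<lambda>n. a n * exp (2 * of_real pi * \<i> * z) powi n) has_sum f z) {-m..})"

(* A meromorphic function on the upper half-plane is represented by a total function in
   the library's normal form "nicely_meromorphic_on": continuous wherever it is not a
   pole, and with the value 0 at poles.  Hence two such functions agree as meromorphic
   functions iff they agree at every point of the half-plane.  Values outside the
   half-plane are irrelevant. *)
definition modular_function :: "(complex \<Rightarrow> complex) \<Rightarrow> bool" where
  "modular_function f \<longleftrightarrow>
     f nicely_meromorphic_on upper_half_plane \<and>
     (\<forall>g\<in>SL2_Z. \<forall>z\<in>upper_half_plane. f (moebius_action g z) = f z) \<and>
     meromorphic_at_cusp f"

definition fundamental_domain :: "complex set" where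
  "fundamental_domain =
     {z\<in>upper_half_plane. -1/2 < Re z \<and> Re z \<le> 1/2 \<and> norm z \<ge> 1 \<and>
        (-1/2 < Re z \<and> Re z < 0 \<longrightarrow> norm z > 1)}"

definition is_zero_or_pole :: "(complex \<Rightarrow> complex) \<Rightarrow> complex \<Rightarrow> bool" where
  "is_zero_or_pole f z \<longleftrightarrow> f z = 0 \<or> is_pole f z"

(* The list ws enumerates the zeros and poles in the fundamental domain by non-decreasing
   imaginary part.  For a non-constant modular function there is such a list and it is
   nonempty; its last element may depend on how ties are ordered, but if the largest
   imaginary part is attained twice then the condition fails for every choice. *)
definition divisor_condition :: "(complex \<Rightarrow> complex) \<Rightarrow> bool" where
  "divisor_condition f \<longleftrightarrow>
     (\<forall>ws. ws \<noteq> [] \<and> distinct ws \<and>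
           set ws = {w\<in>fundamental_domain. is_zero_or_pole f w} \<and>
           sorted_wrt (\<lambda>w w'. Im w \<le> Im w') ws \<longrightarrow>
        (\<forall>s::real. 0 < s \<and> s < 1 \<longrightarrow> \<not> is_zero_or_pole f (last ws + of_real s)))"

(* The identity between the product and the constant is one of meromorphic functions, so
   it is required off a sparse set only: at zeros and poles of the factors, the pointwise
   product of powers does not give the value of the meromorphic function. *)
definition mult_independent_mod_constants ::
    "nat \<Rightarrow> (nat \<Rightarrow> complex \<Rightarrow> complex) \<Rightarrow> bool" where
  "mult_independent_mod_constants n F \<longleftrightarrow>
     \<not> (\<exists>(a::nat \<Rightarrow> int) (c::complex). (\<exists>i\<in>{1..n}. a i \<noteq> 0) \<and>
          (\<forall>\<^sub>\<approx>z\<in>upper_half_plane. (\<Prod>i=1..n. F i z powi a i) = c))"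

end

theory Submission imports Defs begin

unbundle no Formal_Power_Series.fps_syntax

text \<open>
  A zero or pole \<open>w\<close> of \<open>f\<close> in the fundamental domain of maximal imaginary part is a highest zero
  or pole in the whole half-plane, and by the divisor condition those at the same height are exactly
  the integer translates of \<open>w\<close>. Such a \<open>w\<close> exists: if \<open>f\<close> had no zeros and poles, then \<open>f\<close> or
  \<open>1/f\<close> would be holomorphic up to the cusp, hence constant by the maximum principle.
  By the Hermite normal form, \<open>f (g\<^sub>i z) = f (r\<^sub>i z + s\<^sub>i)\<close> with \<open>r\<^sub>i > 0\<close>.
  Take \<open>j\<close> with \<open>r\<^sub>j\<close> minimal among the factors that occur with nonzero exponent. At the point
  \<open>p = (w - s\<^sub>j) / r\<^sub>j\<close> the \<open>j\<close>-th factor has a zero or pole. Another factor with a zero or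
  pole at \<open>p\<close> would have the same \<open>r\<^sub>i\<close> and an \<open>s\<^sub>i\<close> that differs by an integer, so it would be the
  same function. Hence the product has a zero or pole at \<open>p\<close> and is not constant.
\<close>

subsection \<open>Orbits of the modular group\<close>

lemma upper_half_plane_iff [simp]: "z \<in> upper_half_plane \<longleftrightarrow> Im z > 0"
  by (simp add: upper_half_plane_def)

lemma open_upper_half_plane: "open upper_half_plane"
  unfolding upper_half_plane_def by (rule open_halfspace_Im_gt)

lemma connected_upper_half_plane: "connected upper_half_plane"
  unfolding upper_half_plane_def by (rule connected_halfspace_Im_gt)

text \<open>The orbit under the modular group, written with integer quadruples instead of the
  rational matrices of \<open>SL2_Z\<close>, so that matrix products become integer arithmetic. The
  link to \<open>SL2_Z\<close> is made once, in \<open>modular_function_orbit\<close>.\<close>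

definition modular_orbit :: "complex \<Rightarrow> complex set" where
  "modular_orbit z = {(of_int a * z + of_int b) / (of_int c * z + of_int d) | a b c d :: int.
     a * d - b * c = 1}"

text \<open>The determinant is left general: the value 1 gives heights in an orbit, and the
  Euclidean algorithm below uses it for an arbitrary positive determinant. If the denominator
  vanishes, both sides are 0.\<close>

lemma Im_moebius:
  "Im ((of_int a * z + of_int b) / (of_int c * z + of_int d)) =
    of_int (a * d - b * c) * Im z / (norm (of_int c * z + of_int d))\<^sup>2"
  by (simp add: Im_divide cmod_power2 algebra_simps)

lemma linear_form_nonzero:
  assumes "Im z > 0" "c \<noteq> 0 \<or> d \<noteq> 0"
  shows "of_int c * z + of_int d \<noteq> 0"
  using assms by (auto simp: complex_eq_iff)

lemma Im_modular_orbit_pos: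
  assumes "w \<in> modular_orbit z" "Im z > 0"
  shows "Im w > 0"
proof -
  from assms(1) obtain a b c d :: int where abcd: "a * d - b * c = 1"
    and w: "w = (of_int a * z + of_int b) / (of_int c * z + of_int d)"
    by (auto simp: modular_orbit_def)
  have "of_int c * z + of_int d \<noteq> 0"
    using abcd by (intro linear_form_nonzero[OF assms(2)]) auto
  then show ?thesis
    unfolding w Im_moebius abcd using assms(2) by simp
qed

lemma modular_orbit_refl: "z \<in> modular_orbit z"
  unfolding modular_orbit_def mem_Collect_eq
  by (rule exI[of _ 1], rule exI[of _ 0], rule exI[of _ 0], rule exI[of _ 1]) simp

lemma modular_orbit_translate:
  assumes "w \<in> modular_orbit z" "Im z > 0"
  shows "w + of_int n \<in> modular_orbit z"
proof -
  from assms(1) obtain a b c d :: int where abcd: "a * d - b * c = 1"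
    and w: "w = (of_int a * z + of_int b) / (of_int c * z + of_int d)"
    by (auto simp: modular_orbit_def)
  have "of_int c * z + of_int d \<noteq> 0"
    using abcd by (intro linear_form_nonzero[OF assms(2)]) auto
  then have "w + of_int n =
      (of_int (a + n * c) * z + of_int (b + n * d)) / (of_int c * z + of_int d)"
    by (simp add: w field_simps)
  moreover have "(a + n * c) * d - (b + n * d) * c = 1"
    using abcd by (simp add: algebra_simps)
  ultimately show ?thesis
    unfolding modular_orbit_def by blast
qed

lemma modular_orbit_invert:
  assumes "w \<in> modular_orbit z"
  shows "- 1 / w \<in> modular_orbit z"
proof -
  from assms obtain a b c d :: int where abcd: "a * d - b * c = 1"
    and w: "w = (of_int a * z + of_int b) / (of_int c * z + of_int d)"
    by (auto simp: modular_orbit_def)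
  have "- 1 / w = (of_int (- c) * z + of_int (- d)) / (of_int a * z + of_int b)"
    by (simp add: w divide_simps)
  moreover have "(- c) * b - (- d) * a = 1"
    using abcd by (simp add: algebra_simps)
  ultimately show ?thesis
    unfolding modular_orbit_def by blast
qed

section \<open>Reduction of points to the fundamental domain\<close>

lemma finite_small_linear_forms:
  assumes "Im z > 0"
  shows "finite {(c, d :: int). norm (of_int c * z + of_int d) \<le> 1}"
proof (rule finite_subset)
  \<comment> \<open>The imaginary part of the linear form is \<open>c * Im z\<close>, which bounds
    \<open>c\<close>; the triangle inequality then bounds \<open>d\<close>.\<close>
  define M where "M = \<lceil>1 / Im z\<rceil>"
  define N where "N = \<lceil>1 + 1 / Im z * norm z\<rceil>"
  show "{(c, d). norm (of_int c * z + of_int d) \<le> 1} \<subseteq> {- M..M} \<times> {- N..N}"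
  proof safe
    fix c d :: int
    assume le: "norm (of_int c * z + of_int d) \<le> 1"
    have "\<bar>of_int c * Im z\<bar> \<le> norm (of_int c * z + of_int d)"
      using abs_Im_le_cmod[of "of_int c * z + of_int d"] by simp
    with le assms have c: "\<bar>of_int c\<bar> \<le> 1 / Im z"
      by (simp add: abs_mult field_simps)
    have "\<bar>of_int d\<bar> = norm ((of_int c * z + of_int d) - of_int c * z)"
      by simp
    also have "\<dots> \<le> norm (of_int c * z + of_int d) + norm (of_int c * z)"
      by (rule norm_triangle_ineq4)
    also have "\<dots> \<le> 1 + 1 / Im z * norm z"
      using le mult_right_mono[OF c norm_ge_zero[of z]] by (simp add: norm_mult)
    finally have d: "\<bar>of_int d\<bar> \<le> 1 + 1 / Im z * norm z" .
    have "real_of_int \<bar>c\<bar> \<le> of_int M" "real_of_int \<bar>d\<bar> \<le> of_int N"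
      using c d by (simp_all add: M_def N_def) linarith+
    then have "\<bar>c\<bar> \<le> M" "\<bar>d\<bar> \<le> N"
      by (simp_all only: of_int_le_iff)
    then show "c \<in> {- M..M}" "d \<in> {- N..N}"
      by auto
  qed
qed simp

text \<open>Heights in the orbit are \<open>Im z\<close> divided by the square of the norm of
  \<open>c * z + d\<close>, so only finitely many are at least \<open>Im z\<close>. A point of
  greatest height, translated into the strip, has norm at least 1, since otherwise its image under
  \<open>- 1 / w\<close> would be higher.\<close>

lemma modular_orbit_meets_fundamental_domain:
  assumes z: "Im z > 0"
  obtains w where "w \<in> modular_orbit z" "w \<in> fundamental_domain" "Im z \<le> Im w"
proof -
  \<comment> \<open>Heights are collected rather than points, because the integer translates give
    infinitely many orbit points of the same height.\<close>
  define H where "H = {Im w | w. w \<in> modular_orbit z \<and> Im z \<le> Im w}"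
  have "H \<subseteq> (\<lambda>(c, d). Im z / (norm (of_int c * z + of_int d))\<^sup>2) `
      {(c, d :: int). norm (of_int c * z + of_int d) \<le> 1}"
  proof
    fix h assume "h \<in> H"
    then obtain w where "w \<in> modular_orbit z" and h: "h = Im w" "Im z \<le> Im w"
      by (auto simp: H_def)
    then obtain a b c d :: int where abcd: "a * d - b * c = 1"
      and w: "w = (of_int a * z + of_int b) / (of_int c * z + of_int d)"
      by (auto simp: modular_orbit_def)
    define v where "v = norm (of_int c * z + of_int d)"
    have "v > 0"
      using linear_form_nonzero[OF z, of c d] abcd unfolding v_def by (cases "c = 0") auto
    have hv: "h = Im z / v\<^sup>2"
      unfolding h(1) w Im_moebius abcd v_def by simp
    have "Im z * v\<^sup>2 \<le> Im z * 1"
      using h \<open>v > 0\<close> unfolding hv[symmetric] h(1)[symmetric] by (simp add: hv field_simps)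
    then have "v\<^sup>2 \<le> 1"
      using z by (simp only: mult_le_cancel_left_pos)
    then have "v \<le> 1"
      using \<open>v > 0\<close> by (simp add: power_le_one_iff)
    with hv show "h \<in> (\<lambda>(c, d). Im z / (norm (of_int c * z + of_int d))\<^sup>2) `
      {(c, d :: int). norm (of_int c * z + of_int d) \<le> 1}"
      by (intro image_eqI[of _ _ "(c, d)"]) (auto simp: v_def)
  qed
  then have "finite H"
    by (rule finite_subset) (intro finite_imageI finite_small_linear_forms z)
  have "H \<noteq> {}"
    using modular_orbit_refl by (auto simp: H_def)
  have "Max H \<in> H"
    using \<open>finite H\<close> \<open>H \<noteq> {}\<close> by (rule Max_in)
  then obtain w0 where w0: "w0 \<in> modular_orbit z" "Im z \<le> Im w0" "Im w0 = Max H"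
    by (auto simp: H_def)
  have Max: "Im v \<le> Im w0" if "v \<in> modular_orbit z" for v
  proof (cases "Im z \<le> Im v")
    case True
    then show ?thesis
      unfolding w0(3) using that \<open>finite H\<close> by (intro Max_ge) (auto simp: H_def)
  qed (use w0 in auto)
  \<comment> \<open>Rounding up \<open>Re w0 - 1/2\<close> makes the strip open on the left and
    closed on the right, as in the fundamental domain.\<close>
  define w where "w = w0 + of_int (- \<lceil>Re w0 - 1/2\<rceil>)"
  have w: "w \<in> modular_orbit z"
    unfolding w_def by (intro modular_orbit_translate w0 z)
  have Im_w: "Im w = Im w0"
    by (simp add: w_def)
  have Re_w: "- 1/2 < Re w" "Re w \<le> 1/2"
    unfolding w_def by (simp_all, linarith+)
  have "Im w > 0"
    using Im_modular_orbit_pos[OF w z] .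
  then have "w \<noteq> 0"
    by auto
  have inv: "Im (- 1 / w) = Im w / (norm w)\<^sup>2" "Re (- 1 / w) = - Re w / (norm w)\<^sup>2"
    by (simp_all add: Im_divide Re_divide cmod_power2)
  have "Im (- 1 / w) \<le> Im w"
    using Max[OF modular_orbit_invert[OF w]] Im_w by simp
  then have "Im w * 1 \<le> Im w * (norm w)\<^sup>2"
    using \<open>w \<noteq> 0\<close> unfolding inv(1) by (simp add: pos_divide_le_eq)
  then have "1 \<le> (norm w)\<^sup>2"
    using \<open>Im w > 0\<close> by (simp only: mult_le_cancel_left_pos)
  then have norm_w: "1 \<le> norm w"
    by (auto intro: power2_le_imp_le[of 1 "norm w"])
  show thesis
  \<comment> \<open>The left half of the unit arc is excluded from the fundamental domain. On the
    unit circle \<open>- 1 / w\<close> is the reflection of \<open>w\<close> in the imaginary axis,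
    which moves the point to the right half at the same height.\<close>
  proof (cases "norm w = 1 \<and> Re w < 0")
    case True
    have "norm (- 1 / w) = 1"
      using True by (simp add: norm_divide)
    with True Re_w inv \<open>Im w > 0\<close> have "- 1 / w \<in> fundamental_domain"
      by (simp add: fundamental_domain_def)
    moreover have "Im z \<le> Im (- 1 / w)"
      using True w0 Im_w unfolding inv by simp
    ultimately show thesis
      using that modular_orbit_invert[OF w] by blast
  next
    case False
    then have "w \<in> fundamental_domain"
      using norm_w Re_w \<open>Im w > 0\<close> by (auto simp: fundamental_domain_def)
    then show thesis
      using that[OF w] w0 Im_w by simp
  qed
qed

text \<open>A convenient bound below the sharp value sqrt(3)/2; it puts the part of the fundamental
  domain below a given height into a compact rectangle in the half-plane.\<close>

lemma Im_fundamental_domain: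
  assumes "w \<in> fundamental_domain"
  shows "1/2 < Im w"
proof (rule ccontr)
  assume "\<not> 1/2 < Im w"
  moreover have "\<bar>Re w\<bar> \<le> 1/2" "0 < Im w" "1 \<le> norm w"
    using assms by (auto simp: fundamental_domain_def)
  ultimately have "\<bar>Re w\<bar>\<^sup>2 \<le> (1/2)\<^sup>2" "(Im w)\<^sup>2 \<le> (1/2)\<^sup>2"
    by (intro power_mono; simp)+
  moreover have "1 \<le> (norm w)\<^sup>2"
    using \<open>1 \<le> norm w\<close> by simp
  ultimately show False
    by (simp add: cmod_power2 power_divide)
qed

section \<open>Modular functions composed with integer and rational matrices\<close>

lemma modular_function_orbit:
  assumes f: "modular_function f" and z: "Im z > 0" and w: "w \<in> modular_orbit z"
  shows "f w = f z"
proof -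
  from w obtain a b c d :: int where abcd: "a * d - b * c = 1"
    and w: "w = (of_int a * z + of_int b) / (of_int c * z + of_int d)"
    by (auto simp: modular_orbit_def)
  define A :: "rat^2^2" where
    "A = (\<chi> i k. of_int (if i = 1 then if k = 1 then a else b else if k = 1 then c else d))"
  have "det A = of_int (a * d - b * c)"
    by (simp add: det_2 A_def)
  then have "A \<in> SL2_Z"
    unfolding abcd by (simp add: SL2_Z_def A_def)
  moreover have "moebius_action A z = w"
    by (simp add: moebius_action_def A_def w)
  ultimately show ?thesis
    using f z unfolding modular_function_def by force
qed

lemma modular_function_translate:
  assumes "modular_function f" "Im z > 0"
  shows "f (z + of_int n) = f z"
  using assms by (intro modular_function_orbit modular_orbit_translate modular_orbit_refl)

lemma modular_function_invert:
  assumes "modular_function f" "Im z > 0"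
  shows "f (- 1 / z) = f z"
  using assms by (intro modular_function_orbit modular_orbit_invert modular_orbit_refl)

text \<open>The Euclidean algorithm on the first column puts the matrix in Hermite normal form.\<close>

lemma modular_function_integer_moebius:
  assumes f: "modular_function f" and "a * d - b * c > 0"
  shows "\<exists>r s :: real. r > 0 \<and> (\<forall>z. Im z > 0 \<longrightarrow>
    f ((of_int a * z + of_int b) / (of_int c * z + of_int d)) = f (of_real r * z + of_real s))"
  using assms(2)
proof (induction "nat \<bar>c\<bar>" arbitrary: a b c d rule: less_induct)
  case less
  show ?case
  proof (cases "c = 0")
    case True
    then have "real_of_int a / of_int d > 0"
      using less.prems by (simp add: zero_less_divide_iff zero_less_mult_iff)
    moreover have "(of_int a * z + of_int b) / (of_int d) =
        of_real (of_int a / of_int d) * z + of_real (of_int b / of_int d)" for z :: complex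
      by (simp add: add_divide_distrib)
    ultimately show ?thesis
      using True by (intro exI[of _ "of_int a / of_int d"] exI[of _ "of_int b / of_int d"]) simp
  next
    case False
    \<comment> \<open>Translating by \<open>- q\<close> and inverting turns the rows (a, b), (c, d)
      into (-c, -d), (a', b'). The determinant is kept, and the new lower left entry
      \<open>a' = a mod c\<close> is smaller than \<open>c\<close> in absolute value.\<close>
    define q where "q = a div c"
    define a' where "a' = a - q * c"
    define b' where "b' = b - q * d"
    have "a' = a mod c"
      by (simp add: a'_def q_def minus_div_mult_eq_mod)
    then have "nat \<bar>a'\<bar> < nat \<bar>c\<bar>"
      using abs_mod_less[OF False] False by simp
    moreover have det: "a' * d - b' * c > 0"
      using less.prems by (simp add: a'_def b'_def algebra_simps)
    then have "(- c) * b' - (- d) * a' > 0"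
      by (simp add: algebra_simps)
    ultimately obtain r s :: real where "r > 0" and rs: "\<And>z. Im z > 0 \<Longrightarrow>
        f ((of_int (- c) * z + of_int (- d)) / (of_int a' * z + of_int b')) =
        f (of_real r * z + of_real s)"
      using less.hyps[of a' "- c" b' "- d"] by blast
    have "f ((of_int a * z + of_int b) / (of_int c * z + of_int d)) = f (of_real r * z + of_real s)"
      if z: "Im z > 0" for z
    proof -
      define w where "w = (of_int a' * z + of_int b') / (of_int c * z + of_int d)"
      have nz: "of_int c * z + of_int d \<noteq> 0"
        using False by (intro linear_form_nonzero z) simp
      have "Im w > 0"
        unfolding w_def Im_moebius using det z nz
        by (intro divide_pos_pos mult_pos_pos) (simp_all only: of_int_0_less_iff, simp)
      have "(of_int a * z + of_int b) / (of_int c * z + of_int d) = w + of_int q"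
        using nz by (simp add: w_def a'_def b'_def field_simps)
      then have "f ((of_int a * z + of_int b) / (of_int c * z + of_int d)) = f (- 1 / w)"
        using modular_function_translate[OF f \<open>Im w > 0\<close>] modular_function_invert[OF f \<open>Im w > 0\<close>]
        by simp
      also have "- 1 / w = (of_int (- c) * z + of_int (- d)) / (of_int a' * z + of_int b')"
        by (simp add: w_def divide_simps)
      finally show ?thesis
        using rs[OF z] by simp
    qed
    with \<open>r > 0\<close> show ?thesis
      by blast
  qed
qed

lemma ex_common_denominator:
  fixes A :: "rat set"
  assumes "finite A"
  shows "\<exists>N :: int. N > 0 \<and> (\<forall>x\<in>A. of_int N * x \<in> \<int>)"
  using assms
proof induction
  case (insert x A)
  then obtain N :: int where N: "N > 0" "\<forall>y\<in>A. of_int N * y \<in> \<int>"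
    by blast
  obtain a b where x: "x = Fract a b" "b > 0"
    by (cases x) auto
  have "of_int (b * N) * x = of_int (a * N)"
    using x by (simp add: Fract_of_int_quotient)
  moreover have "of_int (b * N) * y \<in> \<int>" if "y \<in> A" for y
    using N that Ints_mult[OF Ints_of_int[of b], of "of_int N * y"] by (simp add: mult.assoc)
  ultimately show ?case
    using N x by (intro exI[of _ "b * N"]) (simp del: of_int_mult)
qed (auto intro: exI[of _ 1])

text \<open>Scaling a matrix by a common denominator \<open>N\<close> does not change its action and
  multiplies the determinant by the square of \<open>N\<close>, so the integer case applies.\<close>

lemma modular_function_affine:
  assumes f: "modular_function f" and g: "g \<in> GL2_plus_Q"
  shows "\<exists>r s :: real. r > 0 \<and>
    (\<forall>z. Im z > 0 \<longrightarrow> f (moebius_action g z) = f (of_real r * z + of_real s))"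
proof -
  obtain N :: int where N: "N > 0" "\<And>i k. of_int N * g $ i $ k \<in> \<int>"
    using ex_common_denominator[of "range (\<lambda>(i, k). g $ i $ k)"] by auto
  define e where "e i k = \<lfloor>of_int N * g $ i $ k\<rfloor>" for i k
  have e: "of_int N * g $ i $ k = of_int (e i k)" for i k
    using N(2)[of i k] unfolding e_def by (auto elim: Ints_cases)
  have "of_int (e 1 1 * e 2 2 - e 1 2 * e 2 1) = (of_int N)\<^sup>2 * det g"
    by (simp add: e[symmetric] det_2 power2_eq_square algebra_simps)
  also have "\<dots> > 0"
    using g N by (simp add: GL2_plus_Q_def)
  finally have "e 1 1 * e 2 2 - e 1 2 * e 2 1 > 0"
    by (simp only: of_int_0_less_iff)
  then obtain r s :: real where "r > 0" and rs: "\<And>z. Im z > 0 \<Longrightarrow>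
      f ((of_int (e 1 1) * z + of_int (e 1 2)) / (of_int (e 2 1) * z + of_int (e 2 2))) =
      f (of_real r * z + of_real s)"
    using modular_function_integer_moebius[OF f] by blast
  have ec: "(of_int (e i k) :: complex) = of_int N * of_rat (g $ i $ k)" for i k
    by (metis e of_rat_mult of_rat_of_int_eq)
  have "moebius_action g z =
      (of_int (e 1 1) * z + of_int (e 1 2)) / (of_int (e 2 1) * z + of_int (e 2 2))" for z
  proof -
    have "(of_int (e 1 1) * z + of_int (e 1 2)) / (of_int (e 2 1) * z + of_int (e 2 2)) =
      (of_int N * (of_rat (g $ 1 $ 1) * z + of_rat (g $ 1 $ 2))) /
      (of_int N * (of_rat (g $ 2 $ 1) * z + of_rat (g $ 2 $ 2)))"
      by (simp add: ec algebra_simps)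
    then show ?thesis
      using N by (simp add: moebius_action_def)
  qed
  with \<open>r > 0\<close> rs show ?thesis
    by metis
qed

subsection \<open>Behaviour at the cusp\<close>

text \<open>The local parameter q at the cusp, with 2 pi in the exponent and not pi as is usual for
  theta functions; it is literally the expression in \<open>meromorphic_at_cusp\<close>.\<close>

abbreviation nome :: "complex \<Rightarrow> complex" where
  "nome z \<equiv> exp (2 * of_real pi * \<i> * z)"

lemma norm_nome: "norm (nome z) = exp (- 2 * pi * Im z)"
  by (simp add: norm_exp_eq_Re)

text \<open>The principal logarithm has imaginary part between -pi and pi. The resulting bound on
  \<open>Re z\<close> later places preimages of a circle on the top edge of a rectangle.\<close>

lemma ex_nome_eq:
  assumes "q \<noteq> 0"
  obtains z where "nome z = q" "\<bar>Re z\<bar> \<le> 1/2"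
proof
  define z where "z = Ln q / (2 * of_real pi * \<i>)"
  have Ln: "2 * of_real pi * \<i> * z = Ln q"
    by (simp add: z_def)
  then show "nome z = q"
    using assms by simp
  from Ln have "Im (2 * of_real pi * \<i> * z) = Im (Ln q)"
    by simp
  then have "2 * pi * Re z = Im (Ln q)"
    by simp
  then have "2 * pi * Re z \<le> 2 * pi * (1/2)" "2 * pi * (- 1/2) \<le> 2 * pi * Re z"
    using mpi_less_Im_Ln[OF assms] Im_Ln_le_pi[OF assms] by simp_all
  then have "Re z \<le> 1/2" "- 1/2 \<le> Re z"
    by (simp_all only: mult_le_cancel_left_pos pi_gt_zero mult_pos_pos zero_less_numeral)
  then show "\<bar>Re z\<bar> \<le> 1/2"
    by linarith
qed

lemma norm_nome_less_iff: "norm (nome z) < exp (- 2 * pi * y) \<longleftrightarrow> y < Im z"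
  by (simp add: norm_nome)

lemma ex_norm_nome_bound:
  assumes "r > 0"
  obtains Y where "\<And>z. Y < Im z \<Longrightarrow> norm (nome z) < r"
proof
  fix z assume "- ln r / (2 * pi) < Im z"
  then have "- 2 * pi * Im z < ln r"
    by (simp add: field_simps)
  then have "exp (- 2 * pi * Im z) < exp (ln r)"
    by (simp only: exp_less_cancel_iff)
  then show "norm (nome z) < r"
    using assms by (simp add: norm_nome)
qed

text \<open>Multiplied by \<open>nome z powi m\<close>, the Fourier expansion becomes a power series
  \<open>P\<close> in q. It is not identically zero by \<open>nonzero\<close>, so the power of q at
  its zero in the origin can be split off. Thus \<open>l\<close> is the order of \<open>f\<close> at
  the cusp.\<close>

lemma meromorphic_at_cusp_factor:
  assumes "meromorphic_at_cusp f" and nonzero: "\<And>Y. \<exists>z. Im z > Y \<and> f z \<noteq> 0"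
  obtains l :: int and Q r where "r > 0" "Q holomorphic_on ball 0 r"
    "\<And>q. q \<in> ball 0 r \<Longrightarrow> Q q \<noteq> 0"
    "\<And>z. norm (nome z) < r \<Longrightarrow> f z = nome z powi l * Q (nome z)"
proof -
  obtain m :: int and a Y where exp:
    "\<And>z. Im z > Y \<Longrightarrow> ((\<lambda>n. a n * nome z powi n) has_sum f z) {-m..}"
    using assms(1) unfolding meromorphic_at_cusp_def by blast
  define b where "b k = a (int k - m)" for k
  \<comment> \<open>The nome maps the half-plane above height \<open>Y\<close> onto the punctured
    disc of this radius, so convergence at every nonzero q of the disc follows from the expansion of
    \<open>f\<close>.\<close>
  define \<rho> where "\<rho> = exp (- 2 * pi * Y)"
  define P where "P q = (\<Sum>k. b k * q ^ k)" for q
  have sums: "(\<lambda>k. b k * nome z ^ k) sums (nome z powi m * f z)" if "norm (nome z) < \<rho>" for z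
  proof -
    have "Im z > Y"
      using that by (simp only: \<rho>_def norm_nome_less_iff)
    have "bij_betw (\<lambda>k. int k - m) UNIV {-m..}"
      by (rule bij_betw_byWitness[of _ "\<lambda>n. nat (n + m)"]) auto
    then have "((\<lambda>k. a (int k - m) * nome z powi (int k - m)) has_sum f z) UNIV"
      using exp[OF \<open>Im z > Y\<close>]
        has_sum_reindex_bij_betw[of _ UNIV "{-m..}" "\<lambda>n. a n * nome z powi n" "f z"] by blast
    then have "((\<lambda>k. nome z powi m * (a (int k - m) * nome z powi (int k - m))) has_sum
        (nome z powi m * f z)) UNIV"
      by (rule has_sum_cmult_right)
    also have "(\<lambda>k. nome z powi m * (a (int k - m) * nome z powi (int k - m))) =
        (\<lambda>k. b k * nome z ^ k)"
      by (simp add: fun_eq_iff b_def power_int_diff)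
    finally show ?thesis
      by (rule has_sum_imp_sums)
  qed
  have P: "P (nome z) = nome z powi m * f z" if "norm (nome z) < \<rho>" for z
    using sums_unique[OF sums[OF that]] by (simp add: P_def)
  have "P holomorphic_on ball 0 \<rho>"
  proof (rule power_series_holomorphic)
    fix q :: complex assume q: "q \<in> ball 0 \<rho>"
    show "(\<lambda>k. b k * (q - 0) ^ k) sums P q"
    proof (cases "q = 0")
      case True
      then show ?thesis
        using powser_sums_zero[of b] by (simp add: P_def)
    next
      case False
      then obtain z where "nome z = q"
        by (rule ex_nome_eq)
      then show ?thesis
        using sums[of z] P[of z] q by simp
    qed
  qed
  have f: "f z = nome z powi (- m) * P (nome z)" if "norm (nome z) < \<rho>" for z
    using P[OF that] by (simp add: power_int_minus)
  have "\<rho> > 0"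
    by (simp add: \<rho>_def)
  obtain z0 where "norm (nome z0) < \<rho>" "P (nome z0) \<noteq> 0"
    using nonzero[of Y] f unfolding \<rho>_def norm_nome_less_iff by fastforce
  obtain k :: nat and Q r where Q: "r > 0" "r \<le> \<rho>" "Q holomorphic_on ball 0 r"
    "\<And>q. q \<in> ball 0 r \<Longrightarrow> Q q \<noteq> 0" "\<And>q. q \<in> ball 0 r \<Longrightarrow> P q = q ^ k * Q q"
  proof (cases "P 0 = 0")
    case True
    have "\<not> P constant_on ball 0 \<rho>"
    proof
      assume "P constant_on ball 0 \<rho>"
      then obtain c where "\<And>q. q \<in> ball 0 \<rho> \<Longrightarrow> P q = c"
        unfolding constant_on_def by blast
      from this[of 0] this[of "nome z0"] show False
        using True \<open>norm (nome z0) < \<rho>\<close> \<open>P (nome z0) \<noteq> 0\<close> \<open>\<rho> > 0\<close> by simp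
    qed
    note factor = holomorphic_factor_zero_nonconstant[OF
        \<open>P holomorphic_on ball 0 \<rho>\<close> open_ball connected_ball _ True this]
    show thesis
    proof (rule factor)
      fix Q r and k :: nat
      assume "0 < r" "ball 0 r \<subseteq> ball (0 :: complex) \<rho>" "Q holomorphic_on ball 0 r"
        "\<And>q. q \<in> ball 0 r \<Longrightarrow> P q = (q - 0) ^ k * Q q" "\<And>q. q \<in> ball 0 r \<Longrightarrow> Q q \<noteq> 0"
      then show thesis
        using that[of r Q k] by (simp add: ball_subset_ball_iff)
    qed (use \<open>\<rho> > 0\<close> in simp)
  next
    \<comment> \<open>The order of \<open>P\<close> is 0 here: \<open>P\<close> itself serves as
      \<open>Q\<close>, on a disc where continuity keeps it away from 0.\<close>
    case False
    have "continuous_on (ball 0 \<rho>) P"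
      using \<open>P holomorphic_on ball 0 \<rho>\<close> by (rule holomorphic_on_imp_continuous_on)
    with False \<open>\<rho> > 0\<close> obtain e where "e > 0"
      and e: "\<And>q. q \<in> ball 0 \<rho> \<Longrightarrow> dist 0 q < e \<Longrightarrow> P q \<noteq> 0"
      using continuous_on_avoid[of "ball 0 \<rho>" P 0 0] by (metis centre_in_ball)
    have "P holomorphic_on ball 0 (min e \<rho>)"
      using \<open>P holomorphic_on ball 0 \<rho>\<close> by (rule holomorphic_on_subset) auto
    then show thesis
      using that[of "min e \<rho>" P 0] \<open>e > 0\<close> \<open>\<rho> > 0\<close> e by simp
  qed
  show thesis
  proof (rule that[OF Q(1,3,4)])
    show "f z = nome z powi (int k - m) * Q (nome z)" if "norm (nome z) < r" for z
      using f[of z] Q(2) Q(5)[of "nome z"] that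
      by (simp add: power_int_diff power_int_minus field_simps)
  qed
qed

text \<open>Every orbit meets either the compact rectangle \<open>K\<close> or the region above it,
  and there the maximum principle for \<open>G\<close> on a disc bounds \<open>h\<close> by its
  values on the top edge of \<open>K\<close>. So the norm of \<open>h\<close> has a global maximum
  in the half-plane. Invariance is assumed through \<open>orbit\<close> so that reciprocals of
  modular functions are covered as well.\<close>

lemma bounded_modular_constant:
  assumes hol: "h holomorphic_on upper_half_plane"
    and orbit: "\<And>z w. Im z > 0 \<Longrightarrow> w \<in> modular_orbit z \<Longrightarrow> h w = h z"
    and G: "G holomorphic_on ball 0 \<rho>" "\<rho> > 0"
    and cusp: "\<And>z. norm (nome z) < \<rho> \<Longrightarrow> h z = G (nome z)"
  shows "h constant_on upper_half_plane"
proof -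
  obtain Y0 where Y0: "\<And>z. Y0 < Im z \<Longrightarrow> norm (nome z) < \<rho>"
    using ex_norm_nome_bound[OF G(2)] by blast
  \<comment> \<open>The bound 1 keeps the point i in \<open>K\<close>; the bound
    \<open>Y0 + 1\<close> puts the circle belonging to height \<open>Y\<close> inside the disc where
    \<open>G\<close> is holomorphic.\<close>
  define Y where "Y = max 1 (Y0 + 1)"
  have "1 \<le> Y"
    by (simp add: Y_def)
  define R where "R = exp (- 2 * pi * Y)"
  have "R < \<rho>"
    using Y0[of "Complex 0 Y"] norm_nome[of "Complex 0 Y"] by (simp add: R_def Y_def)
  define K where "K = cbox (Complex (-1/2) (1/2)) (Complex (1/2) Y)"
  have K: "z \<in> K \<longleftrightarrow> \<bar>Re z\<bar> \<le> 1/2 \<and> 1/2 \<le> Im z \<and> Im z \<le> Y" for z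
    by (auto simp: K_def in_cbox_complex_iff abs_le_iff)
  have "compact K"
    unfolding K_def by (rule compact_cbox)
  moreover have "Complex 0 1 \<in> K"
    by (simp add: K Y_def)
  moreover have "continuous_on K (\<lambda>z. norm (h z))"
    by (intro continuous_on_norm holomorphic_on_imp_continuous_on holomorphic_on_subset[OF hol])
      (auto simp: K)
  ultimately obtain \<zeta> where \<zeta>: "\<zeta> \<in> K" "\<And>z. z \<in> K \<Longrightarrow> norm (h z) \<le> norm (h \<zeta>)"
    using continuous_attains_sup[of K "\<lambda>z. norm (h z)"] by blast
  have G_le: "norm (G q) \<le> norm (h \<zeta>)" if "q \<in> cball 0 R" for q
  proof (rule maximum_modulus_frontier[OF _ _ _ _ that])
    have "G holomorphic_on cball 0 R"
      using \<open>R < \<rho>\<close> by (intro holomorphic_on_subset[OF G(1)]) auto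
    then show "G holomorphic_on interior (cball 0 R)" "continuous_on (closure (cball 0 R)) G"
      by (auto intro: holomorphic_on_subset holomorphic_on_imp_continuous_on)
    \<comment> \<open>A point of this circle is the nome of a point on the top edge of
      \<open>K\<close>, where \<open>h\<close> is already bounded.\<close>
    fix q :: complex assume "q \<in> frontier (cball 0 R)"
    then have q: "norm q = R"
      by (simp add: R_def)
    then have "q \<noteq> 0"
      by (auto simp: R_def)
    then obtain z where z: "nome z = q" "\<bar>Re z\<bar> \<le> 1/2"
      by (rule ex_nome_eq)
    then have "Im z = Y"
      using q norm_nome[of z] by (simp add: R_def)
    then have "norm (h z) \<le> norm (h \<zeta>)"
      using z \<open>1 \<le> Y\<close> by (intro \<zeta>) (simp add: K)
    moreover have "h z = G q"
      using cusp[of z] z q \<open>R < \<rho>\<close> by simp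
    ultimately show "norm (G q) \<le> norm (h \<zeta>)"
      by simp
  qed simp
  have le: "norm (h z) \<le> norm (h \<zeta>)" if "z \<in> upper_half_plane" for z
  proof -
    from that obtain w where w: "w \<in> modular_orbit z" "w \<in> fundamental_domain"
      using modular_orbit_meets_fundamental_domain[of z] by auto
    have "norm (h w) \<le> norm (h \<zeta>)"
    proof (cases "Im w \<le> Y")
      case True
      then show ?thesis
        using w(2) Im_fundamental_domain[OF w(2)]
        by (intro \<zeta>) (auto simp: K fundamental_domain_def)
    next
      case False
      then have "norm (nome w) < R"
        unfolding R_def norm_nome_less_iff by simp
      then show ?thesis
        using G_le[of "nome w"] cusp[of w] \<open>R < \<rho>\<close> by simp
    qed
    then show ?thesis
      using orbit[OF _ w(1)] that by simp
  qed
  have "\<zeta> \<in> upper_half_plane"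
    using \<zeta>(1) by (simp add: K)
  with hol le show ?thesis
    by (intro maximum_modulus_principle[OF hol open_upper_half_plane connected_upper_half_plane
          open_upper_half_plane]) auto
qed

subsection \<open>Zeros and poles of modular functions\<close>

text \<open>In the normal form a pole carries the value 0, and at a nonzero value the function is
  continuous. Zeros and poles can therefore be treated together as solutions of
  \<open>f z = 0\<close>.\<close>

lemma modular_function_zero_or_pole:
  assumes "modular_function f" "Im z > 0"
  shows "is_zero_or_pole f z \<longleftrightarrow> f z = 0"
proof -
  have "f z = 0" if "is_pole f z"
  proof (rule ccontr)
    assume "f z \<noteq> 0"
    then have "f \<midarrow>z\<rightarrow> f z"
      using assms unfolding modular_function_def nicely_meromorphic_on_def by auto
    with that show False
      unfolding is_pole_def using not_tendsto_and_filterlim_at_infinity[of "at z" f "f z"] by simp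
  qed
  then show ?thesis
    by (auto simp: is_zero_or_pole_def)
qed

text \<open>The identity theorem for meromorphic functions on the connected half-plane, for the
  value 0.\<close>

lemma nonconstant_modular_function_cosparse_nonzero:
  assumes "modular_function f" "\<not> f constant_on upper_half_plane"
  shows "\<forall>\<^sub>\<approx>z\<in>upper_half_plane. f z \<noteq> 0"
  using nicely_meromorphic_imp_constant_or_avoid[of f upper_half_plane 0]
    open_upper_half_plane connected_upper_half_plane assms
  unfolding modular_function_def constant_on_def by blast

lemma nonconstant_modular_function_cusp_factor:
  assumes f: "modular_function f" and nonconst: "\<not> f constant_on upper_half_plane"
  obtains l :: int and Q r where "r > 0" "Q holomorphic_on ball 0 r"
    "\<And>q. q \<in> ball 0 r \<Longrightarrow> Q q \<noteq> 0"
    "\<And>z. norm (nome z) < r \<Longrightarrow> f z = nome z powi l * Q (nome z)"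
proof (rule meromorphic_at_cusp_factor)
  show "meromorphic_at_cusp f"
    using f by (simp add: modular_function_def)
  fix Y :: real
  \<comment> \<open>A point of the half-plane above \<open>Y\<close>; since the zeros are sparse,
    there are nonzero values arbitrarily close to it.\<close>
  define p where "p = Complex 0 (max Y 0 + 1)"
  have "p \<in> upper_half_plane"
    by (simp add: p_def)
  then have "eventually (\<lambda>z. f z \<noteq> 0) (at p)"
    using nonconstant_modular_function_cosparse_nonzero[OF f nonconst]
    by (simp add: eventually_cosparse_open_eq open_upper_half_plane)
  moreover have "eventually (\<lambda>z. z \<in> {z. Im z > Y}) (at p)"
    by (intro eventually_at_in_open' open_halfspace_Im_gt) (simp add: p_def)
  ultimately have "eventually (\<lambda>z. Im z > Y \<and> f z \<noteq> 0) (at p)"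
    by eventually_elim simp
  then show "\<exists>z. Im z > Y \<and> f z \<noteq> 0"
    using eventually_happens'[of "at p"] by simp
qed (use that in blast)

text \<open>The sign of the order \<open>l\<close> at the cusp decides whether \<open>f\<close> or
  its reciprocal extends holomorphically to q = 0. Without zeros and poles either one is holomorphic
  on the half-plane, so \<open>bounded_modular_constant\<close> applies.\<close>

lemma nonconstant_modular_function_has_zero_or_pole:
  assumes f: "modular_function f" and nonconst: "\<not> f constant_on upper_half_plane"
  shows "\<exists>z. Im z > 0 \<and> is_zero_or_pole f z"
proof (rule ccontr)
  assume no: "\<not> (\<exists>z. Im z > 0 \<and> is_zero_or_pole f z)"
  then have nz: "f z \<noteq> 0" if "Im z > 0" for z
    using that by (auto simp: is_zero_or_pole_def)
  have "f analytic_on upper_half_plane"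
    using f no by (intro nicely_meromorphic_without_singularities)
      (auto simp: modular_function_def is_zero_or_pole_def)
  then have hol: "f holomorphic_on upper_half_plane"
    by (rule analytic_imp_holomorphic)
  obtain l :: int and Q r where Q: "r > 0" "Q holomorphic_on ball 0 r"
    "\<And>q. q \<in> ball 0 r \<Longrightarrow> Q q \<noteq> 0"
    "\<And>z. norm (nome z) < r \<Longrightarrow> f z = nome z powi l * Q (nome z)"
    by (rule nonconstant_modular_function_cusp_factor[OF f nonconst]) blast
  show False
  proof (cases "l \<ge> 0")
    case True
    have "f constant_on upper_half_plane"
    proof (rule bounded_modular_constant[where \<rho> = r])
      show "(\<lambda>q. q ^ nat l * Q q) holomorphic_on ball 0 r"
        by (intro holomorphic_intros Q)
      show "f z = nome z ^ nat l * Q (nome z)" if "norm (nome z) < r" for z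
        using Q(4)[OF that] True by (simp add: power_int_def)
    qed (use f hol Q modular_function_orbit in auto)
    with nonconst show False
      by contradiction
  next
    case False
    have "(\<lambda>z. inverse (f z)) constant_on upper_half_plane"
    proof (rule bounded_modular_constant[where \<rho> = r])
      show "(\<lambda>q. q ^ nat (- l) * inverse (Q q)) holomorphic_on ball 0 r"
        by (intro holomorphic_intros Q) (use Q(3) in auto)
      show "inverse (f z) = nome z ^ nat (- l) * inverse (Q (nome z))" if "norm (nome z) < r" for z
        using Q(4)[OF that] False by (simp add: power_int_def power_inverse)
      show "(\<lambda>z. inverse (f z)) holomorphic_on upper_half_plane"
        by (intro holomorphic_intros hol) (use nz in auto)
    qed (use f Q modular_function_orbit in auto)
    then have "f constant_on upper_half_plane"
      unfolding constant_on_def by (metis inverse_inverse_eq)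
    with nonconst show False
      by contradiction
  qed
qed

text \<open>The factor \<open>Q\<close> excludes zeros and poles near the cusp; the rest of the
  fundamental domain lies in a compact set, where a sparse set is finite. This provides the list
  that \<open>divisor_condition\<close> speaks about.\<close>

lemma finite_zeros_fundamental_domain:
  assumes f: "modular_function f" and nonconst: "\<not> f constant_on upper_half_plane"
  shows "finite {w \<in> fundamental_domain. f w = 0}"
proof -
  obtain l :: int and Q r where Q: "r > 0" "Q holomorphic_on ball 0 r"
    "\<And>q. q \<in> ball 0 r \<Longrightarrow> Q q \<noteq> 0"
    "\<And>z. norm (nome z) < r \<Longrightarrow> f z = nome z powi l * Q (nome z)"
    by (rule nonconstant_modular_function_cusp_factor[OF f nonconst]) blast
  obtain Y where Y: "\<And>z. Y < Im z \<Longrightarrow> norm (nome z) < r"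
    using ex_norm_nome_bound[OF Q(1)] by blast
  define K where "K = cbox (Complex (-1/2) (1/2)) (Complex (1/2) Y)"
  have "{z. f z = 0} sparse_in upper_half_plane"
    using nonconstant_modular_function_cosparse_nonzero[OF f nonconst]
    by (simp add: eventually_cosparse)
  then have "{z. f z = 0} sparse_in K"
    by (rule sparse_in_subset) (auto simp: K_def in_cbox_complex_iff)
  then have "finite (K \<inter> {z. f z = 0})"
    by (rule sparse_in_compact_finite) (simp add: K_def)
  moreover have "{w \<in> fundamental_domain. f w = 0} \<subseteq> K \<inter> {z. f z = 0}"
  proof safe
    fix w assume w: "w \<in> fundamental_domain" "f w = 0"
    have "Im w \<le> Y"
    proof (rule ccontr)
      assume "\<not> Im w \<le> Y"
      then have "norm (nome w) < r"
        by (intro Y) simp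
      then show False
        using Q(3)[of "nome w"] Q(4)[of w] w by simp
    qed
    then show "w \<in> K"
      using w Im_fundamental_domain[of w]
      by (simp add: K_def in_cbox_complex_iff fundamental_domain_def)
  qed
  ultimately show ?thesis
    by (rule rev_finite_subset)
qed

text \<open>Carries the condition from the fundamental domain to the whole half-plane: each zero or
  pole has an orbit representative in the domain that is at least as high, and a horizontal shift
  can be reduced modulo 1 by periodicity.\<close>

lemma divisor_condition_top:
  assumes f: "modular_function f" and nonconst: "\<not> f constant_on upper_half_plane"
    and div: "divisor_condition f"
  obtains w where "Im w > 0" "f w = 0" "\<And>z. Im z > Im w \<Longrightarrow> f z \<noteq> 0"
    "\<And>s :: real. f (w + of_real s) = 0 \<Longrightarrow> s \<in> \<int>"
proof -
  define S where "S = {w \<in> fundamental_domain. is_zero_or_pole f w}"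
  have fd: "Im w > 0" if "w \<in> fundamental_domain" for w
    using that by (simp add: fundamental_domain_def)
  have S: "w \<in> S \<longleftrightarrow> w \<in> fundamental_domain \<and> f w = 0" for w
    using modular_function_zero_or_pole[OF f fd] by (auto simp: S_def)
  then have "S = {w \<in> fundamental_domain. f w = 0}"
    by blast
  then have "finite S"
    using finite_zeros_fundamental_domain[OF f nonconst] by simp
  then obtain xs where "set xs = S" "distinct xs"
    using finite_distinct_list by blast
  define ws where "ws = sort_key Im xs"
  have ws: "set ws = S" "distinct ws" "sorted_wrt (\<lambda>w w'. Im w \<le> Im w') ws"
    using \<open>set xs = S\<close> \<open>distinct xs\<close> sorted_sort_key[of Im xs]
    by (simp_all add: ws_def sorted_map)
  have low: "\<exists>w\<in>S. Im z \<le> Im w" if "Im z > 0" "f z = 0" for z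
  proof -
    obtain w where "w \<in> modular_orbit z" "w \<in> fundamental_domain" "Im z \<le> Im w"
      using modular_orbit_meets_fundamental_domain[OF \<open>Im z > 0\<close>] by blast
    then show ?thesis
      using modular_function_orbit[OF f \<open>Im z > 0\<close>] that S by auto
  qed
  then have "S \<noteq> {}"
    using nonconstant_modular_function_has_zero_or_pole[OF f nonconst]
      modular_function_zero_or_pole[OF f] by blast
  then have "ws \<noteq> []"
    using ws by auto
  define w where "w = last ws"
  have "w \<in> S"
    using \<open>ws \<noteq> []\<close> ws by (auto simp: w_def)
  then have w: "Im w > 0" "f w = 0"
    using S fd by auto
  have max: "Im v \<le> Im w" if "v \<in> S" for v
  proof -
    have ws_eq: "butlast ws @ [w] = ws"
      using \<open>ws \<noteq> []\<close> by (simp add: w_def)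
    then have "sorted_wrt (\<lambda>w w'. Im w \<le> Im w') (butlast ws @ [w])"
      using ws(3) by simp
    moreover have "v \<in> set (butlast ws @ [w])"
      using ws(1) ws_eq that by simp
    ultimately show ?thesis
      by (auto simp: sorted_wrt_append)
  qed
  show thesis
  proof (rule that[OF w])
    show "f z \<noteq> 0" if "Im z > Im w" for z
      using low[of z] max that w by fastforce
    fix s :: real assume s: "f (w + of_real s) = 0"
    \<comment> \<open>The fractional part lies in [0, 1), and the divisor condition forbids the open
      interval, so only 0 remains.\<close>
    have "f (w + of_real (frac s)) = 0"
      using modular_function_translate[OF f, of "w + of_real s" "- \<lfloor>s\<rfloor>"] s w
      by (simp add: frac_def add_diff_eq)
    then have "is_zero_or_pole f (last ws + of_real (frac s))"
      by (simp add: is_zero_or_pole_def w_def)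
    then have "\<not> (0 < frac s \<and> frac s < 1)"
      using div \<open>ws \<noteq> []\<close> ws unfolding divisor_condition_def S_def by blast
    then have "frac s = 0"
      using frac_lt_1[of s] frac_ge_0[of s] by linarith
    then show "s \<in> \<int>"
      by simp
  qed
qed

subsection \<open>Multiplicative independence\<close>

text \<open>If \<open>u\<close> tended to 0, its power would tend to 0 for positive
  \<open>k\<close>, and the reciprocal of the power would for negative \<open>k\<close>. Stated for
  general \<open>u\<close> so that a pole of \<open>f\<close> is handled by taking the reciprocal as
  \<open>u\<close>.\<close>

lemma powi_tendsto_nonzero_imp_not_tendsto_0:
  fixes u :: "'a \<Rightarrow> 'b :: real_normed_field"
  assumes "((\<lambda>z. u z powi k) \<longlongrightarrow> L) F" "L \<noteq> 0" "k \<noteq> 0" "F \<noteq> bot"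
  shows "\<not> (u \<longlongrightarrow> 0) F"
proof
  assume u: "(u \<longlongrightarrow> 0) F"
  have power: "((\<lambda>z. u z ^ m) \<longlongrightarrow> 0) F" if "m > 0" for m
    using tendsto_power[OF u, of m] that by (simp add: power_0_left)
  show False
  proof (cases "k > 0")
    case True
    then have "((\<lambda>z. u z powi k) \<longlongrightarrow> 0) F"
      using power[of "nat k"] by (simp add: power_int_def)
    then show False
      using tendsto_unique[OF \<open>F \<noteq> bot\<close> assms(1)] \<open>L \<noteq> 0\<close> by blast
  next
    case False
    have "((\<lambda>z. inverse (u z powi k)) \<longlongrightarrow> inverse L) F"
      using assms(1,2) by (rule tendsto_inverse)
    moreover have "((\<lambda>z. inverse (u z powi k)) \<longlongrightarrow> 0) F"
      using power[of "nat (- k)"] False \<open>k \<noteq> 0\<close> by (simp add: power_int_def power_inverse)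
    ultimately have "inverse L = 0"
      using tendsto_unique[OF \<open>F \<noteq> bot\<close>] by blast
    then show False
      using \<open>L \<noteq> 0\<close> by simp
  qed
qed

lemma modular_function_isCont:
  assumes "modular_function f" "Im z > 0" "f z \<noteq> 0"
  shows "isCont f z"
  using assms unfolding modular_function_def nicely_meromorphic_on_def isCont_def by auto

lemma modular_function_zero_cases:
  assumes "modular_function f" "Im z > 0" "f z = 0"
  shows "(f \<longlongrightarrow> 0) (at z) \<or> ((\<lambda>z. inverse (f z)) \<longlongrightarrow> 0) (at z)"
proof (cases "is_pole f z")
  case True
  then show ?thesis
    using is_pole_tendsto[of f z] by (simp add: o_def)
next
  case False
  then have "f \<midarrow>z\<rightarrow> f z"
    using assms unfolding modular_function_def nicely_meromorphic_on_def by auto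
  then show ?thesis
    using assms by simp
qed

text \<open>Injectivity keeps the image off the centre, so statements on punctured neighbourhoods
  can be pulled back along the affine map.\<close>

lemma filterlim_affine_at:
  fixes r s z :: "'a :: real_normed_field"
  assumes "r \<noteq> 0"
  shows "filterlim (\<lambda>z. r * z + s) (at (r * z + s)) (at z)"
proof (rule filterlim_atI)
  show "((\<lambda>z. r * z + s) \<longlongrightarrow> r * z + s) (at z)"
    by (intro tendsto_intros)
  show "eventually (\<lambda>v. r * v + s \<noteq> r * z + s) (at z)"
    using assms by (simp add: eventually_at_filter)
qed

theorem theorem1p5:
  fixes f :: "complex \<Rightarrow> complex" and n :: nat and g :: "nat \<Rightarrow> rat^2^2"
  assumes "modular_function f"
    and "\<not> f constant_on upper_half_plane"
    and "divisor_condition f"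
    and "\<And>i. i \<in> {1..n} \<Longrightarrow> g i \<in> GL2_plus_Q"
    and "\<And>i k. i \<in> {1..n} \<Longrightarrow> k \<in> {1..n} \<Longrightarrow> i \<noteq> k \<Longrightarrow>
           \<exists>z\<in>upper_half_plane. f (moebius_action (g i) z) \<noteq> f (moebius_action (g k) z)"
  shows "mult_independent_mod_constants n (\<lambda>i z. f (moebius_action (g i) z))"
  unfolding mult_independent_mod_constants_def
proof
  note f = assms(1) and nonconst = assms(2)
  assume "\<exists>(a::nat \<Rightarrow> int) (c::complex). (\<exists>i\<in>{1..n}. a i \<noteq> 0) \<and>
    (\<forall>\<^sub>\<approx>z\<in>upper_half_plane. (\<Prod>i=1..n. f (moebius_action (g i) z) powi a i) = c)"
  then obtain a :: "nat \<Rightarrow> int" and c :: complex where a: "\<exists>i\<in>{1..n}. a i \<noteq> 0"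
    and prod_c: "\<forall>\<^sub>\<approx>z\<in>upper_half_plane. (\<Prod>i=1..n. f (moebius_action (g i) z) powi a i) = c"
    by blast
  have "\<forall>i\<in>{1..n}. \<exists>r s :: real. r > 0 \<and>
      (\<forall>z. Im z > 0 \<longrightarrow> f (moebius_action (g i) z) = f (of_real r * z + of_real s))"
    using modular_function_affine[OF f assms(4)] by blast
  then obtain r s :: "nat \<Rightarrow> real" where r_pos: "\<And>i. i \<in> {1..n} \<Longrightarrow> r i > 0"
    and affine: "\<And>i z. i \<in> {1..n} \<Longrightarrow> Im z > 0 \<Longrightarrow>
      f (moebius_action (g i) z) = f (of_real (r i) * z + of_real (s i))"
    unfolding bchoice_iff by blast
  define A where "A i z = complex_of_real (r i) * z + of_real (s i)" for i z
  obtain w where w: "Im w > 0" "f w = 0" "\<And>z. Im z > Im w \<Longrightarrow> f z \<noteq> 0"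
    "\<And>t :: real. f (w + of_real t) = 0 \<Longrightarrow> t \<in> \<int>"
    using divisor_condition_top[OF f nonconst assms(3)] by blast
  \<comment> \<open>Factors with exponent 0 contribute 1 to the product and must not influence the
    choice of the minimal \<open>r j\<close>.\<close>
  define I where "I = {i \<in> {1..n}. a i \<noteq> 0}"
  have "finite I" "I \<noteq> {}"
    using a by (auto simp: I_def)
  then have "Min (r ` I) \<in> r ` I"
    by (intro Min_in) auto
  then obtain j where j: "j \<in> I" "r j = Min (r ` I)"
    by auto
  have r_min: "r j \<le> r i" if "i \<in> I" for i
    unfolding j(2) using \<open>finite I\<close> that by simp
  have rj: "r j > 0"
    using j(1) r_pos by (simp add: I_def)
  define p where "p = (w - of_real (s j)) / of_real (r j)"
  have Im_p: "Im p = Im w / r j"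
    by (simp add: p_def)
  then have "Im p > 0"
    using w(1) rj by simp
  have Aj: "A j p = w"
    using rj by (simp add: A_def p_def)

  text \<open>By the minimality of \<open>r j\<close> the affine images of \<open>p\<close> lie at least as high as \<open>w\<close>,
    so the divisor condition leaves \<open>j\<close> as the only factor with a zero or pole at \<open>p\<close>.\<close>
  have other: "f (A i p) \<noteq> 0 \<and> Im (A i p) > 0" if "i \<in> I" "i \<noteq> j" for i
  proof (cases "r i = r j")
    case True
    have A_eq: "A i z = A j z + of_real (s i - s j)" for z
      by (simp add: A_def True)
    have "f (A i p) \<noteq> 0"
    proof
      assume "f (A i p) = 0"
      then have "s i - s j \<in> \<int>"
        using w(4)[of "s i - s j"] by (simp add: A_eq Aj)
      then obtain m where "s i - s j = of_int m"
        by (rule Ints_cases)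
      then have A_eq': "A i z = A j z + of_int m" for z
        by (simp only: A_eq of_real_of_int_eq)
      have "f (moebius_action (g i) z) = f (moebius_action (g j) z)" if z: "Im z > 0" for z
      proof -
        have "f (A i z) = f (A j z)"
          unfolding A_eq' using z rj by (intro modular_function_translate f) (simp add: A_def)
        then show ?thesis
          using affine[of i z] affine[of j z] z \<open>i \<in> I\<close> j(1) by (simp add: A_def I_def)
      qed
      then show False
        using assms(5)[of i j] that j(1) by (auto simp: I_def)
    qed
    moreover have "Im (A i p) = Im w"
      by (simp add: A_eq Aj)
    ultimately show ?thesis
      using w(1) by simp
  next
    case False
    then have "r i > r j"
      using r_min[OF that(1)] by simp
    then have "Im (A i p) > Im w"
      using w(1) rj by (simp add: A_def Im_p field_simps)
    then show ?thesis
      using w(1,3) by force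
  qed

  \<comment> \<open>The product of all remaining factors, which is continuous and nonzero at
    \<open>p\<close>; any zero or pole of the full product at \<open>p\<close> comes from the factor
    \<open>j\<close>.\<close>
  define H where "H z = (\<Prod>i\<in>I - {j}. f (A i z) powi a i)" for z
  have "(H \<longlongrightarrow> H p) (at p)"
    unfolding H_def
  proof (intro tendsto_prod tendsto_power_int)
    fix i assume i: "i \<in> I - {j}"
    then show "f (A i p) \<noteq> 0"
      using other by simp
    show "((\<lambda>z. f (A i z)) \<longlongrightarrow> f (A i p)) (at p)"
      using i other[of i] unfolding A_def
      by (intro isCont_tendsto_compose[OF modular_function_isCont[OF f]] tendsto_intros) auto
  qed
  moreover have "H p \<noteq> 0"
    using other \<open>finite I\<close> by (simp add: H_def)
  ultimately have H_nz: "eventually (\<lambda>z. H z \<noteq> 0) (at p)"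
    by (rule tendsto_imp_eventually_ne)
  have lim: "filterlim (A j) (at w) (at p)"
    using filterlim_affine_at[of "of_real (r j)" "of_real (s j)" p] rj Aj
    by (simp add: A_def[abs_def])
  have "eventually (\<lambda>z. f z \<noteq> 0) (at w)"
    using nonconstant_modular_function_cosparse_nonzero[OF f nonconst] w(1)
    by (simp add: eventually_cosparse_open_eq open_upper_half_plane)
  then have f_nz: "eventually (\<lambda>z. f (A j z) \<noteq> 0) (at p)"
    using lim by (rule eventually_compose_filterlim)
  \<comment> \<open>Equality off a sparse set gives equality on a punctured neighbourhood of
    \<open>p\<close>, which suffices for comparing limits.\<close>
  have "eventually (\<lambda>z. (\<Prod>i=1..n. f (moebius_action (g i) z) powi a i) = c) (at p)"
    using prod_c \<open>Im p > 0\<close> by (simp add: eventually_cosparse_open_eq open_upper_half_plane)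
  moreover have "eventually (\<lambda>z. z \<in> upper_half_plane) (at p)"
    using \<open>Im p > 0\<close> by (intro eventually_at_in_open' open_upper_half_plane) simp
  ultimately have c: "eventually (\<lambda>z. f (A j z) powi a j * H z = c) (at p)"
  proof eventually_elim
    case (elim z)
    have "f (A j z) powi a j * H z = (\<Prod>i\<in>I. f (A i z) powi a i)"
      unfolding H_def using \<open>finite I\<close> j(1) by (rule prod.remove[symmetric])
    also have "\<dots> = (\<Prod>i=1..n. f (moebius_action (g i) z) powi a i)"
      using elim(2) affine by (intro prod.mono_neutral_cong_left) (auto simp: I_def A_def)
    finally show ?case
      using elim(1) by simp
  qed
  \<comment> \<open>At points near \<open>p\<close> both factors are nonzero, hence so is their
    product, the constant \<open>c\<close>.\<close>
  have "eventually (\<lambda>z. c \<noteq> 0) (at p)"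
    using c H_nz f_nz by eventually_elim auto
  then have "c \<noteq> 0"
    by simp
  have "eventually (\<lambda>z. c / H z = f (A j z) powi a j) (at p)"
    using c H_nz by eventually_elim (auto simp: field_simps)
  moreover have "((\<lambda>z. c / H z) \<longlongrightarrow> c / H p) (at p)"
    using \<open>(H \<longlongrightarrow> H p) (at p)\<close> \<open>H p \<noteq> 0\<close> by (intro tendsto_intros)
  ultimately have powi: "((\<lambda>z. f (A j z) powi a j) \<longlongrightarrow> c / H p) (at p)"
    by (rule Lim_transform_eventually[rotated])
  \<comment> \<open>The same limit with reciprocal base and opposite exponent: the first form
    excludes a zero of \<open>f\<close> at \<open>w\<close>, this one a pole.\<close>
  then have powi': "((\<lambda>z. inverse (f (A j z)) powi (- a j)) \<longlongrightarrow> c / H p) (at p)"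
    by (simp add: power_int_minus power_int_inverse)
  have nz: "c / H p \<noteq> 0" "a j \<noteq> 0" "- a j \<noteq> 0"
    using \<open>c \<noteq> 0\<close> \<open>H p \<noteq> 0\<close> j(1) by (auto simp: I_def)
  have "\<not> ((\<lambda>z. f (A j z)) \<longlongrightarrow> 0) (at p)"
    using powi_tendsto_nonzero_imp_not_tendsto_0[OF powi nz(1,2)] by simp
  moreover have "\<not> ((\<lambda>z. inverse (f (A j z))) \<longlongrightarrow> 0) (at p)"
    using powi_tendsto_nonzero_imp_not_tendsto_0[OF powi' nz(1,3)] by simp
  ultimately show False
    using modular_function_zero_cases[OF f w(1,2)] filterlim_compose[OF _ lim] by blast
qed

end
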